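(* Let $n,m\ge1$ be integers, $0<\alpha<nm$, and for $i=1,\dots,m$ let $1\le p_i<nm/\alpha$, $\frac1{q_i}=\frac1{p_i}-\frac{\alpha}{nm}$, and $\frac1q=\sum_{i=1}^m\frac1{q_i}$. Let $u,w_1,\dots,w_m$ be weights on $\mathbb{R}^n$ satisfying $$\sup_Q\left(\frac1{|Q|}\int_Q u\right)^{1/q}\prod_{i=1}^m\left(\frac1{|Q|}\int_Q w_i^{-p_i'}\right)^{1/p_i'}<\infty,$$ where the supremum is over all cubes $Q\subset\mathbb{R}^n$ and, when $p_i=1$, $\left(\frac1{|Q|}\int_Q w_i^{-p_i'}\right)^{1/p_i'}$ is understood as $(\inf_Q w_i)^{-1}$. Then there is a constant $C>0$ such that for every $\vec f=(f_1,\dots,f_m)$ $$\|\mathcal{M}_\alpha\vec f\|_{L^{q,\infty}(u)}\le C\prod_{i=1}^m\|f_iw_i\|_{L^{p_i}}.$$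
   Context: A weight is a nonnegative measurable function on $\mathbb{R}^n$; the $w_i$ are understood to be positive a.e., since negative powers occur. Cubes have sides parallel to the axes; $p'$ is the conjugate exponent of $p$. $\inf_Q$ is the essential infimum. The multilinear fractional maximal operator is $\mathcal{M}_\alpha\vec f(x)=\sup_{Q\ni x}|Q|^{\alpha/n}\prod_{i=1}^m\frac1{|Q|}\int_Q|f_i|$, the supremum over all cubes $Q$ containing $x$. $\|F\|_{L^{q,\infty}(u)}=\sup_{\lambda>0}\lambda\,u(\{|F|>\lambda\})^{1/q}$ with $u(E)=\int_E u$. *)

theory Defs
  imports "HOL-Analysis.Analysis"
begin

text \<open>
  Averages, suprema and norms may be infinite, so they all take values in \<^typ>\<open>ennreal\<close>,
  where \<open>0 * \<infinity> = 0\<close>, \<open>inverse 0 = \<infinity>\<close> and \<open>inverse \<infinity> = 0\<close>.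
  Measurability and integration refer to Lebesgue measure.
\<close>

definition weight :: "(real ^ 'n \<Rightarrow> real) \<Rightarrow> bool" where
  "weight w \<longleftrightarrow> w \<in> borel_measurable lebesgue \<and> (\<forall>x. 0 \<le> w x)"

definition cubes :: "(real ^ 'n) set set" where
  "cubes = {cbox a b | a b. \<exists>l>0. \<forall>i. b $ i - a $ i = l}"

definition avg :: "(real ^ 'n) set \<Rightarrow> (real ^ 'n \<Rightarrow> ennreal) \<Rightarrow> ennreal" where
  "avg Q g = (\<integral>\<^sup>+x\<in>Q. g x \<partial>lebesgue) / emeasure lebesgue Q"

definition ess_inf :: "(real ^ 'n) set \<Rightarrow> (real ^ 'n \<Rightarrow> real) \<Rightarrow> ennreal" where
  "ess_inf Q w = Sup {c. AE x in lebesgue. x \<in> Q \<longrightarrow> c \<le> ennreal (w x)}"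

text \<open>Only used for exponents \<open>a > 0\<close>.\<close>

definition epow :: "ennreal \<Rightarrow> real \<Rightarrow> ennreal" where
  "epow t a = (if t = \<infinity> then \<infinity> else ennreal (enn2real t powr a))"

text \<open>Only used for \<open>p > 1\<close>.\<close>

definition conj_exp :: "real \<Rightarrow> real" where
  "conj_exp p = p / (p - 1)"

text \<open>
  The factor of \<open>w\<close> in the weight condition. As \<open>0 powr a = 0\<close> for real powers, the integrand
  is \<open>0\<close> rather than \<open>\<infinity>\<close> at zeros of \<open>w\<close>; this is immaterial for \<open>w > 0\<close> almost everywhere.
\<close>

definition dual_avg :: "(real ^ 'n) set \<Rightarrow> real \<Rightarrow> (real ^ 'n \<Rightarrow> real) \<Rightarrow> ennreal" where
  "dual_avg Q p w =
    (if p = 1 then inverse (ess_inf Q w)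
     else epow (avg Q (\<lambda>x. ennreal (w x powr (- conj_exp p)))) (1 / conj_exp p))"

definition weight_const ::
  "nat \<Rightarrow> (nat \<Rightarrow> real) \<Rightarrow> real \<Rightarrow> (real ^ 'n \<Rightarrow> real) \<Rightarrow> (nat \<Rightarrow> real ^ 'n \<Rightarrow> real) \<Rightarrow> ennreal" where
  "weight_const m p q u w =
    (SUP Q\<in>cubes. epow (avg Q (\<lambda>x. ennreal (u x))) (1 / q) * (\<Prod>i=1..m. dual_avg Q (p i) (w i)))"

definition frac_maximal ::
  "nat \<Rightarrow> real \<Rightarrow> (nat \<Rightarrow> real ^ 'n \<Rightarrow> complex) \<Rightarrow> real ^ 'n \<Rightarrow> ennreal" where
  "frac_maximal m \<alpha> f x =
    (SUP Q\<in>{Q \<in> cubes. x \<in> Q}.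
      ennreal (measure lebesgue Q powr (\<alpha> / real CARD('n))) *
      (\<Prod>i=1..m. avg Q (\<lambda>y. ennreal (norm (f i y)))))"

definition Lp_norm :: "real \<Rightarrow> (real ^ 'n \<Rightarrow> complex) \<Rightarrow> ennreal" where
  "Lp_norm p g = epow (\<integral>\<^sup>+x. ennreal (norm (g x) powr p) \<partial>lebesgue) (1 / p)"

definition weak_Lq_norm :: "real \<Rightarrow> (real ^ 'n \<Rightarrow> real) \<Rightarrow> (real ^ 'n \<Rightarrow> ennreal) \<Rightarrow> ennreal" where
  "weak_Lq_norm q u F =
    (SUP t\<in>{0<..}. ennreal t * epow (\<integral>\<^sup>+x\<in>{x. F x > ennreal t}. ennreal (u x) \<partial>lebesgue) (1 / q))"

end

theory Submission
  imports Defs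
begin

text \<open>
  Write \<open>R\<close> for the cube concentric with \<open>Q\<close> and four times as large, and \<open>\<Phi>(Q)\<close> for the
  quantity whose supremum is the maximal function. Hoelder's inequality on \<open>Q\<close>, with the dual
  weights integrated over the larger \<open>R\<close>, and the weight condition on \<open>R\<close> bound
  \<open>u(R)^(1/q) \<Phi>(Q)\<close> by a constant times the product of the norms of \<open>f\<^sub>i w\<^sub>i\<close> in \<open>L^(p\<^sub>i)(Q)\<close>;
  no doubling of \<open>u\<close> is needed because the dilation is already built into this estimate.
  For a disjoint Vitali subfamily of cubes with \<open>\<Phi>(Q) > t\<close> the \<open>q\<close>-th powers of these bounds
  are summed by a discrete Hoelder inequality with exponents \<open>q / p\<^sub>i\<close>, whose sum is at least 1
  since \<open>1 / q = (\<Sum>\<^sub>i 1 / p\<^sub>i) - \<alpha> / n\<close>.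
\<close>

section \<open>Powers of extended nonnegative numbers\<close>

lemma epow_0 [simp]: "epow 0 a = 0"
  by (simp add: epow_def)

lemma epow_top [simp]: "epow top a = top"
  by (simp add: epow_def)

lemma epow_exponent_1 [simp]: "epow t 1 = t"
  by (cases t) (auto simp: epow_def)

lemma epow_one [simp]: "epow 1 a = 1"
  by (simp add: epow_def)

lemma epow_ennreal: "0 \<le> x \<Longrightarrow> epow (ennreal x) a = ennreal (x powr a)"
  by (simp add: epow_def)

lemma epow_eq_0_iff [simp]: "epow t a = 0 \<longleftrightarrow> t = 0"
  by (cases t) (auto simp: epow_def)

lemma epow_mono: "0 \<le> a \<Longrightarrow> s \<le> t \<Longrightarrow> epow s a \<le> epow t a"
  by (cases s; cases t) (auto simp: epow_ennreal intro!: powr_mono2 ennreal_leI simp: top_unique)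

text \<open>Every exponent fixes both 0 and \<open>top\<close>, so the convention
  \<open>0 * top = 0\<close> gives the same value on both sides. Only finite nonzero arguments are
  left to the law for real powers.\<close>

lemma epow_mult: "epow (s * t) a = epow s a * epow t a"
proof (cases "s = 0 \<or> t = 0 \<or> s = top \<or> t = top")
  case True
  then show ?thesis
    by (auto simp: ennreal_mult_top ennreal_top_mult)
next
  case False
  then obtain x y where "s = ennreal x" "0 \<le> x" "t = ennreal y" "0 \<le> y"
    by (metis ennreal_cases)
  then show ?thesis
    by (simp add: epow_ennreal powr_mult flip: ennreal_mult)
qed

lemma epow_epow: "epow (epow t a) b = epow t (a * b)"
  by (cases t) (auto simp: epow_ennreal powr_powr)

lemma epow_prod: "epow (\<Prod>i\<in>I. t i) a = (\<Prod>i\<in>I. epow (t i) a)"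
  by (induction I rule: infinite_finite_induct)
     (auto simp: epow_mult)

section \<open>Continuous and discrete Hoelder inequalities\<close>

text \<open>Young's inequality is applied to \<open>f\<close> and \<open>g\<close> divided by their
  norms and then integrated. If an integral on the right is 0, that function vanishes almost
  everywhere and so does the product; if neither is 0 and one is infinite, the right side is
  infinite.\<close>

lemma Holder_nn_integral:
  fixes f g :: "'a \<Rightarrow> real"
  assumes p: "1 < p"
    and [measurable]: "f \<in> borel_measurable M" "g \<in> borel_measurable M"
    and nonneg: "\<And>x. 0 \<le> f x" "\<And>x. 0 \<le> g x"
  shows "(\<integral>\<^sup>+x. ennreal (f x * g x) \<partial>M) \<le>
    epow (\<integral>\<^sup>+x. ennreal (f x powr p) \<partial>M) (1 / p) *
    epow (\<integral>\<^sup>+x. ennreal (g x powr conj_exp p) \<partial>M) (1 / conj_exp p)"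
    (is "?I \<le> epow ?A _ * epow ?B _")
proof -
  define p' where "p' = conj_exp p"
  have p': "p' > 1" "1 / p + 1 / p' = 1"
    using p by (auto simp: p'_def conj_exp_def field_simps)
  have zero: "?I = 0" if "?A = 0 \<or> ?B = 0"
  proof -
    from that have "(AE x in M. f x = 0) \<or> (AE x in M. g x = 0)"
      by (auto simp: nn_integral_0_iff_AE ennreal_eq_0_iff)
    then have "AE x in M. ennreal (f x * g x) = 0"
      by (auto elim: eventually_mono)
    then show ?thesis
      by (simp add: nn_integral_0_iff_AE)
  qed
  show ?thesis
  proof (cases "?A = 0 \<or> ?B = 0 \<or> ?A = top \<or> ?B = top")
    case True
    then show ?thesis
      using zero by (auto simp: ennreal_mult_top ennreal_top_mult)
  next
    case False
    have pos: "\<exists>R. X = ennreal R \<and> 0 < R" if "X \<noteq> 0" "X \<noteq> top" for X :: ennreal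
      using that by (cases X) (auto simp: less_le)
    from False obtain A B where A: "?A = ennreal A" "A > 0" and B: "?B = ennreal B" "B > 0"
      using pos[of ?A] pos[of ?B] by blast
    define a b where "a = A powr (1 / p)" and "b = B powr (1 / p')"
    have ab: "a > 0" "b > 0" "a powr p = A" "b powr p' = B"
      using A B p p' by (auto simp: a_def b_def powr_powr)
    have "f x * g x \<le> (a * b) * (f x powr p / (p * A) + g x powr p' / (p' * B))" for x
    proof -
      have "(f x / a) * (g x / b) \<le> (f x / a) powr p / p + (g x / b) powr p' / p'"
        using p p' ab nonneg by (intro Youngs_inequality) auto
      also have "\<dots> = f x powr p / (p * A) + g x powr p' / (p' * B)"
        using ab nonneg by (simp add: powr_divide mult.commute)
      finally show ?thesis
        using ab by (simp add: field_simps)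
    qed
    then have "?I \<le> (\<integral>\<^sup>+x. ennreal ((a * b) * (f x powr p / (p * A) + g x powr p' / (p' * B))) \<partial>M)"
      by (intro nn_integral_mono ennreal_leI) auto
    also have "\<dots> = (\<integral>\<^sup>+x. ennreal (a * b / (p * A)) * ennreal (f x powr p) +
        ennreal (a * b / (p' * B)) * ennreal (g x powr p') \<partial>M)"
      using ab A B p p'
      by (intro nn_integral_cong)
         (simp add: distrib_left flip: ennreal_mult ennreal_plus)
    also have "\<dots> = ennreal (a * b / (p * A)) * ennreal A + ennreal (a * b / (p' * B)) * ennreal B"
      using A B by (simp add: nn_integral_add nn_integral_cmult p'_def)
    also have "\<dots> = ennreal (a * b * (1 / p + 1 / p'))"
      using ab A B p p'(1) by (simp add: distrib_left flip: ennreal_mult ennreal_plus)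
    also have "\<dots> = epow ?A (1 / p) * epow ?B (1 / p')"
      using ab A B p' by (simp add: epow_ennreal a_def b_def ennreal_mult)
    finally show ?thesis
      by (simp add: p'_def)
  qed
qed

text \<open>Since \<open>b i\<close> \<le> 1, passing to the exponents
  \<open>\<theta> i / sum \<theta> I\<close>, which are no larger and sum to 1, can only increase
  the product. What remains is the weighted inequality of geometric and arithmetic means, that is,
  Jensen's inequality for exp at the points \<open>ln (b i)\<close>; if some \<open>b i\<close> is
  0, the product vanishes.\<close>

lemma prod_powr_le_weighted_sum:
  fixes b \<theta> :: "'i \<Rightarrow> real"
  assumes "finite I" and \<theta>: "\<And>i. i \<in> I \<Longrightarrow> 0 < \<theta> i" "1 \<le> sum \<theta> I"
    and b: "\<And>i. i \<in> I \<Longrightarrow> 0 \<le> b i" "\<And>i. i \<in> I \<Longrightarrow> b i \<le> 1"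
  shows "(\<Prod>i\<in>I. b i powr \<theta> i) \<le> (\<Sum>i\<in>I. \<theta> i / sum \<theta> I * b i)"
proof (cases "\<exists>i\<in>I. b i = 0")
  case True
  then have "(\<Prod>i\<in>I. b i powr \<theta> i) = 0"
    using \<open>finite I\<close> by (auto intro!: prod_zero)
  also have "\<dots> \<le> (\<Sum>i\<in>I. \<theta> i / sum \<theta> I * b i)"
    using \<theta> b by (intro sum_nonneg mult_nonneg_nonneg divide_nonneg_nonneg) (auto intro: less_imp_le)
  finally show ?thesis .
next
  case False
  then have pos: "0 < b i" if "i \<in> I" for i
    using b that by force
  have "(\<Prod>i\<in>I. b i powr \<theta> i) = exp (\<Sum>i\<in>I. \<theta> i * ln (b i))"
    unfolding exp_sum[OF \<open>finite I\<close>] using pos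
    by (intro prod.cong refl) (metis less_irrefl powr_def)
  also have "\<dots> \<le> exp (\<Sum>i\<in>I. \<theta> i / sum \<theta> I * ln (b i))"
  proof (subst exp_le_cancel_iff, intro sum_mono)
    fix i assume i: "i \<in> I"
    have "\<theta> i / sum \<theta> I \<le> \<theta> i"
      using \<theta> i by (simp add: divide_le_eq less_imp_le)
    moreover have "ln (b i) \<le> 0"
      using pos b i by simp
    ultimately show "\<theta> i * ln (b i) \<le> \<theta> i / sum \<theta> I * ln (b i)"
      by (intro mult_right_mono_neg)
  qed
  also have "\<dots> \<le> (\<Sum>i\<in>I. \<theta> i / sum \<theta> I * exp (ln (b i)))"
  proof -
    have "I \<noteq> {}" using \<theta> by auto
    have "(\<Sum>i\<in>I. \<theta> i / sum \<theta> I) = 1"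
      using \<theta> by (simp flip: sum_divide_distrib)
    moreover have "0 \<le> \<theta> i / sum \<theta> I" if "i \<in> I" for i
      using \<theta> that by (simp add: less_imp_le)
    ultimately
    have "exp (\<Sum>i\<in>I. (\<theta> i / sum \<theta> I) *\<^sub>R ln (b i)) \<le> (\<Sum>i\<in>I. \<theta> i / sum \<theta> I * exp (ln (b i)))"
      using \<open>finite I\<close> \<open>I \<noteq> {}\<close>
      by (intro convex_on_sum[OF _ _ exp_convex]) simp_all
    then show ?thesis by simp
  qed
  also have "\<dots> = (\<Sum>i\<in>I. \<theta> i / sum \<theta> I * b i)"
    using pos by (intro sum.cong) auto
  finally show ?thesis .
qed

text \<open>Both sides scale alike when a row \<open>a i\<close> is multiplied by a positive
  constant, so each row may be normalised to sum 1. Its entries are then at most 1,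
  \<open>prod_powr_le_weighted_sum\<close> bounds each product by a convex combination over
  \<open>i\<close>, and summation over \<open>j\<close> gives 1.\<close>

lemma sum_prod_epow_le:
  assumes "finite I" "finite J" and \<theta>: "\<And>i. i \<in> I \<Longrightarrow> 0 < \<theta> i" "1 \<le> sum \<theta> I"
  shows "(\<Sum>j\<in>J. \<Prod>i\<in>I. epow (a i j) (\<theta> i)) \<le> (\<Prod>i\<in>I. epow (\<Sum>j\<in>J. a i j) (\<theta> i))"
proof -
  define A where "A i = (\<Sum>j\<in>J. a i j)" for i
  \<comment> \<open>Zero row sums are split off first: because \<open>0 * top = 0\<close>, an
    infinite row sum makes the right side infinite only if no other row sum vanishes.\<close>
  consider (zero) i where "i \<in> I" "A i = 0"
    | (infinite) i where "i \<in> I" "A i = top" "\<And>i. i \<in> I \<Longrightarrow> A i \<noteq> 0"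
    | (real) "\<And>i. i \<in> I \<Longrightarrow> A i \<noteq> 0" "\<And>i. i \<in> I \<Longrightarrow> A i \<noteq> top"
    by blast
  then have "(\<Sum>j\<in>J. \<Prod>i\<in>I. epow (a i j) (\<theta> i)) \<le> (\<Prod>i\<in>I. epow (A i) (\<theta> i))"
  proof cases
    case zero
    then have "a i j = 0" if "j \<in> J" for j
      using that \<open>finite J\<close> by (simp add: A_def)
    then have "(\<Prod>i\<in>I. epow (a i j) (\<theta> i)) = 0" if "j \<in> J" for j
      using that zero \<open>finite I\<close> by (intro prod_zero bexI[of _ i]) auto
    then have "(\<Sum>j\<in>J. \<Prod>i\<in>I. epow (a i j) (\<theta> i)) = 0"
      by (rule sum.neutral[OF ballI])
    then show ?thesis by (simp only: zero_le)
  next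
    case infinite
    then have "(\<Prod>i\<in>I. epow (A i) (\<theta> i)) = top"
      using \<open>finite I\<close> by (subst prod.remove[of _ i]) (auto simp: ennreal_top_mult)
    then show ?thesis by simp
  next
    case real
    define R where "R i = enn2real (A i)" for i
    define x where "x i j = enn2real (a i j)" for i j
    have R: "A i = ennreal (R i)" "R i > 0" if "i \<in> I" for i
      using real that by (auto simp: R_def enn2real_positive_iff top.not_eq_extremum zero_less_iff_neq_zero)
    have x: "a i j = ennreal (x i j)" "x i j \<ge> 0" if "i \<in> I" "j \<in> J" for i j
    proof -
      have "a i j \<noteq> top"
        using real(2)[OF that(1)] \<open>finite J\<close> that(2) by (auto simp: A_def)
      then show "a i j = ennreal (x i j)" "x i j \<ge> 0"
        by (auto simp: x_def top.not_eq_extremum)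
    qed
    have sumx: "(\<Sum>j\<in>J. x i j) = R i" if "i \<in> I" for i
    proof -
      have "ennreal (\<Sum>j\<in>J. x i j) = ennreal (R i)"
        using x that by (subst sum_ennreal[symmetric]) (auto simp: R(1)[symmetric] A_def)
      then show ?thesis
        using x R that by (subst (asm) ennreal_inj) (auto intro!: sum_nonneg simp: less_imp_le)
    qed
    define b where "b i j = x i j / R i" for i j
    have b0: "0 \<le> b i j" if "i \<in> I" "j \<in> J" for i j
      using x R that by (simp add: b_def less_imp_le)
    have b1: "b i j \<le> 1" if "i \<in> I" "j \<in> J" for i j
    proof -
      have "x i j \<le> R i"
        using x that \<open>finite J\<close> by (subst sumx[symmetric]) (auto intro!: member_le_sum)
      then show ?thesis using R that by (simp add: b_def)
    qed
    have sumb: "(\<Sum>j\<in>J. b i j) = 1" if "i \<in> I" for i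
      using sumx[OF that] R[OF that] by (simp add: b_def flip: sum_divide_distrib)
    have "(\<Sum>j\<in>J. \<Prod>i\<in>I. b i j powr \<theta> i) \<le> (\<Sum>j\<in>J. \<Sum>i\<in>I. \<theta> i / sum \<theta> I * b i j)"
      using assms b0 b1 by (intro sum_mono prod_powr_le_weighted_sum) auto
    also have "\<dots> = (\<Sum>i\<in>I. \<theta> i / sum \<theta> I * (\<Sum>j\<in>J. b i j))"
      by (subst sum.swap) (simp add: sum_distrib_left)
    also have "\<dots> = 1"
      using sumb \<theta> by (simp flip: sum_divide_distrib)
    finally have le1: "(\<Sum>j\<in>J. \<Prod>i\<in>I. b i j powr \<theta> i) \<le> 1" .
    have "(\<Sum>j\<in>J. \<Prod>i\<in>I. epow (a i j) (\<theta> i)) = (\<Sum>j\<in>J. ennreal (\<Prod>i\<in>I. x i j powr \<theta> i))"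
      using x by (intro sum.cong refl) (simp add: epow_ennreal flip: prod_ennreal)
    also have "\<dots> = ennreal (\<Sum>j\<in>J. \<Prod>i\<in>I. x i j powr \<theta> i)"
      by (intro sum_ennreal prod_nonneg) auto
    also have "(\<Sum>j\<in>J. \<Prod>i\<in>I. x i j powr \<theta> i) =
        (\<Sum>j\<in>J. (\<Prod>i\<in>I. R i powr \<theta> i) * (\<Prod>i\<in>I. b i j powr \<theta> i))"
    proof (intro sum.cong refl, subst prod.distrib[symmetric], intro prod.cong refl)
      fix i j assume "j \<in> J" "i \<in> I"
      then show "x i j powr \<theta> i = R i powr \<theta> i * b i j powr \<theta> i"
        using R(2)[of i] x(2)[of i j] by (subst powr_mult[symmetric]) (auto simp: b_def less_imp_le)
    qed
    also have "\<dots> \<le> (\<Prod>i\<in>I. R i powr \<theta> i)"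
      using le1 by (simp add: mult_left_le prod_nonneg flip: sum_distrib_left)
    also have "ennreal (\<Prod>i\<in>I. R i powr \<theta> i) = (\<Prod>i\<in>I. epow (A i) (\<theta> i))"
      using R by (simp add: epow_ennreal less_imp_le flip: prod_ennreal)
    finally show ?thesis
      by (simp add: ennreal_leI)
  qed
  then show ?thesis by (simp add: A_def)
qed

section \<open>Cubes and a finite Vitali covering lemma\<close>

text \<open>With the centre and half the side length as parameters, a concentric dilation merely
  scales \<open>r\<close>, and a family of cubes becomes a set of pairs.\<close>

definition cube :: "real ^ 'n \<Rightarrow> real \<Rightarrow> (real ^ 'n) set" where
  "cube c r = {x. \<forall>i. \<bar>x $ i - c $ i\<bar> \<le> r}"

lemma cube_eq_cbox: "cube c r = cbox (c - vec r) (c + vec r)"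
  by (auto simp: cube_def mem_box_cart abs_le_iff algebra_simps)

lemma cube_in_cubes: "0 < r \<Longrightarrow> cube c r \<in> cubes"
  unfolding cubes_def cube_eq_cbox by (auto intro!: exI exI[of _ "2 * r"])

lemma cubesE:
  assumes "Q \<in> cubes"
  obtains c r where "0 < r" "Q = cube c r"
proof -
  obtain a b l where l: "l > 0" "\<And>i. b $ i - a $ i = l" and Q: "Q = cbox a b"
    using assms by (auto simp: cubes_def)
  define c where "c = a + vec (l / 2)"
  have "a = c - vec (l / 2)" "b = c + vec (l / 2)"
    using l(2) by (auto simp: c_def vec_eq_iff algebra_simps)
  then show thesis
    using that[of "l / 2" c] l Q by (simp add: cube_eq_cbox)
qed

lemma sets_cube [measurable]: "cube c r \<in> sets lebesgue"
  by (simp add: cube_eq_cbox)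

lemma emeasure_cube:
  fixes c :: "real ^ 'n"
  assumes "0 < r"
  shows "emeasure lebesgue (cube c r) = ennreal ((2 * r) ^ CARD('n))"
proof -
  have ne: "cbox (c - vec r) (c + vec r) \<noteq> {}"
    using assms by (simp add: interval_eq_empty_cart not_less)
  have "emeasure lebesgue (cube c r) = ennreal (measure lborel (cbox (c - vec r) (c + vec r)))"
    using emeasure_lborel_cbox_finite[of "c - vec r" "c + vec r"]
    by (simp add: cube_eq_cbox emeasure_eq_ennreal_measure)
  also have "measure lborel (cbox (c - vec r) (c + vec r)) = (2 * r) ^ CARD('n)"
    by (simp add: content_cbox_cart[OF ne])
  finally show ?thesis .
qed

lemma mem_cube_center: "0 \<le> r \<Longrightarrow> c \<in> cube c r"
  by (simp add: cube_def)

lemma cube_mono: "r \<le> s \<Longrightarrow> cube c r \<subseteq> cube c s"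
  by (auto simp: cube_def intro: order_trans)

lemma cube_subset_interior_double:
  assumes "0 < r"
  shows "cube c r \<subseteq> interior (cube c (2 * r))"
proof
  fix x assume "x \<in> cube c r"
  then have x: "\<bar>x $ i - c $ i\<bar> \<le> r" for i
    by (simp add: cube_def)
  have "\<bar>x $ i - c $ i\<bar> < 2 * r" for i
    using x[of i] assms by linarith
  then show "x \<in> interior (cube c (2 * r))"
    by (auto simp: cube_eq_cbox mem_box_cart abs_less_iff algebra_simps)
qed

text \<open>Through a common point of the two cubes, each coordinate of x - c' is bounded by 2r + r
  + r' \<le> 4r'. The smaller cube enters doubled, hence the factor 4 in place of the customary
  3.\<close>

lemma cube_double_subset:
  assumes "cube c r \<inter> cube c' r' \<noteq> {}" "r \<le> r'"
  shows "cube c (2 * r) \<subseteq> cube c' (4 * r')"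
proof
  fix x assume x: "x \<in> cube c (2 * r)"
  obtain y where y: "y \<in> cube c r" "y \<in> cube c' r'"
    using assms(1) by blast
  have "\<bar>x $ i - c' $ i\<bar> \<le> 4 * r'" for i
  proof -
    have "\<bar>x $ i - c $ i\<bar> \<le> 2 * r" "\<bar>y $ i - c $ i\<bar> \<le> r" "\<bar>y $ i - c' $ i\<bar> \<le> r'"
      using x y by (auto simp: cube_def)
    then show ?thesis
      using assms(2) by linarith
  qed
  then show "x \<in> cube c' (4 * r')"
    by (simp add: cube_def)
qed

text \<open>Greedy selection: a cube of maximal size is kept, the cubes meeting it are dropped, and
  induction treats the rest. By \<open>cube_double_subset\<close> the doubles of the dropped cubes
  lie in the fourfold dilate of the kept one.\<close>

lemma Vitali_finite_cubes:
  fixes I :: "((real ^ 'n) \<times> real) set"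
  assumes "finite I" "\<And>c r. (c, r) \<in> I \<Longrightarrow> 0 < r"
  shows "\<exists>J\<subseteq>I. disjoint_family_on (\<lambda>(c, r). cube c r) J \<and>
    (\<Union>(c, r)\<in>I. cube c (2 * r)) \<subseteq> (\<Union>(c, r)\<in>J. cube c (4 * r))"
  using assms
proof (induction I rule: finite_psubset_induct)
  case (psubset I)
  show ?case
  proof (cases "I = {}")
    case True
    then show ?thesis
      by (auto simp: disjoint_family_on_def)
  next
    case False
    obtain p where "p \<in> I" and p_max: "\<And>q. q \<in> I \<Longrightarrow> snd q \<le> snd p"
      using Max_in[of "snd ` I"] Max_ge[of "snd ` I"] False \<open>finite I\<close>
      by (metis (no_types, lifting) finite_imageI image_iff image_is_empty)
    obtain c r where p: "p = (c, r)" by (cases p)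
    have cr: "(c, r) \<in> I" "0 < r" and le: "\<And>c' r'. (c', r') \<in> I \<Longrightarrow> r' \<le> r"
      using \<open>p \<in> I\<close> psubset.prems p_max unfolding p by force+
    \<comment> \<open>The kept cube contains its centre and so meets itself; this removes it from
      \<open>I'\<close> and makes \<open>I'\<close> a proper subset of \<open>I\<close>.\<close>
    define I' where "I' = {(c', r') \<in> I. cube c' r' \<inter> cube c r = {}}"
    have "(c, r) \<notin> I'"
      using mem_cube_center[of r c] cr by (auto simp: I'_def)
    then have "I' \<subset> I"
      using cr by (auto simp: I'_def)
    then obtain J' where J': "J' \<subseteq> I'" "disjoint_family_on (\<lambda>(c, r). cube c r) J'"
      "(\<Union>(c, r)\<in>I'. cube c (2 * r)) \<subseteq> (\<Union>(c, r)\<in>J'. cube c (4 * r))"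
      using psubset.IH[of I'] psubset.prems by blast
    have "disjoint_family_on (\<lambda>(c, r). cube c r) (insert (c, r) J')"
      using J'(1,2) unfolding disjoint_family_on_def I'_def by fast
    moreover have "(\<Union>(c, r)\<in>I. cube c (2 * r)) \<subseteq> (\<Union>(c, r)\<in>insert (c, r) J'. cube c (4 * r))"
    proof
      fix x assume "x \<in> (\<Union>(c, r)\<in>I. cube c (2 * r))"
      then obtain c' r' where x: "(c', r') \<in> I" "x \<in> cube c' (2 * r')"
        by auto
      show "x \<in> (\<Union>(c, r)\<in>insert (c, r) J'. cube c (4 * r))"
      proof (cases "cube c' r' \<inter> cube c r = {}")
        case True
        then have "x \<in> (\<Union>(c, r)\<in>I'. cube c (2 * r))"
          using x by (auto simp: I'_def)
        then show ?thesis
          using J'(3) by auto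
      next
        case False
        then have "x \<in> cube c (4 * r)"
          using cube_double_subset[OF False le[OF x(1)]] x(2) by blast
        then show ?thesis by auto
      qed
    qed
    moreover have "insert (c, r) J' \<subseteq> I"
      using J'(1) \<open>I' \<subset> I\<close> cr by auto
    ultimately show ?thesis by blast
  qed
qed

section \<open>The estimate on a single cube\<close>

text \<open>The supremum in \<open>ess_inf\<close> is already that of a sequence of admissible
  constants, so only countably many null sets have to be discarded.\<close>

lemma AE_ess_inf_le:
  fixes Q :: "(real ^ 'n) set"
  shows "AE x in lebesgue. x \<in> Q \<longrightarrow> ess_inf Q w \<le> ennreal (w x)"
proof -
  define S where "S = {c. AE x in lebesgue. x \<in> Q \<longrightarrow> c \<le> ennreal (w x)}"
  have "0 \<in> S"
    by (simp add: S_def)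
  then obtain s :: "nat \<Rightarrow> ennreal" where s: "range s \<subseteq> S" "Sup S = Sup (range s)"
    using ennreal_Sup_countable_SUP[of S] by auto
  then have "AE x in lebesgue. \<forall>k. x \<in> Q \<longrightarrow> s k \<le> ennreal (w x)"
    unfolding AE_all_countable by (auto simp: S_def image_subset_iff)
  then show ?thesis
    using s(2) by (auto simp: ess_inf_def S_def[symmetric] intro!: SUP_least elim!: eventually_mono)
qed

text \<open>For p = 1 the reciprocal of the essential infimum is pulled out of the integral; for p >
  1 this is Hoelder's inequality for f w on \<open>Q\<close> and 1/w on \<open>R\<close>. Rewriting
  the integral over \<open>R\<close> as an average costs the factor \<open>V\<close> to the power
  1/p' = 1 - 1/p. Taking the dual factor over the larger set is what later allows \<open>u\<close>
  to be measured on the dilated cube.\<close>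

lemma nn_integral_le_dual_avg:
  fixes f :: "real ^ 'n \<Rightarrow> complex"
  assumes [measurable]: "Q \<in> sets lebesgue" "R \<in> sets lebesgue" "f \<in> borel_measurable lebesgue"
    and "Q \<subseteq> R" and V: "emeasure lebesgue R = ennreal V" "0 < V"
    and p: "1 \<le> p" and w: "weight w" "AE x in lebesgue. 0 < w x"
  shows "(\<integral>\<^sup>+x\<in>Q. ennreal (norm (f x)) \<partial>lebesgue) \<le>
    epow (\<integral>\<^sup>+x\<in>Q. ennreal (norm (f x * complex_of_real (w x)) powr p) \<partial>lebesgue) (1 / p) *
    (dual_avg R p w * ennreal (V powr (1 - 1 / p)))"
    (is "?L \<le> epow ?A _ * _")
proof -
  have [measurable]: "w \<in> borel_measurable lebesgue" and w0: "\<And>x. 0 \<le> w x"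
    using w by (auto simp: weight_def)
  show ?thesis
  proof (cases "p = 1")
    case True
    let ?e = "ess_inf R w"
    have "AE x in lebesgue. ennreal (norm (f x)) * indicator Q x \<le>
        inverse ?e * (ennreal (norm (f x * complex_of_real (w x)) powr p) * indicator Q x)"
      using AE_ess_inf_le[of R w] w(2)
    proof eventually_elim
      case (elim x)
      show ?case
      proof (cases "x \<in> Q")
        case True
        then have e: "?e \<le> ennreal (w x)"
          using elim \<open>Q \<subseteq> R\<close> by auto
        have "1 \<le> inverse ?e * ennreal (w x)"
        \<comment> \<open>For \<open>?e = 0\<close> the inverse is \<open>top\<close>, and
          positivity of \<open>w x\<close> prevents the degenerate product
          \<open>top * 0 = 0\<close>.\<close>
        proof (cases "?e = 0")
          case True
          then show ?thesis
            using elim by (simp add: ennreal_top_mult)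
        next
          case False
          have "?e \<noteq> top"
            using e by (auto simp: top_unique)
          then have "?e / ?e = 1"
            using False by (intro ennreal_divide_self) (auto simp: less_top)
          then have "1 = inverse ?e * ?e"
            by (simp add: divide_ennreal_def mult.commute)
          also have "\<dots> \<le> inverse ?e * ennreal (w x)"
            using e by (intro mult_left_mono) auto
          finally show ?thesis .
        qed
        then have "ennreal (norm (f x)) * 1 \<le> ennreal (norm (f x)) * (inverse ?e * ennreal (w x))"
          by (intro mult_left_mono) auto
        then show ?thesis
          using w0 \<open>p = 1\<close> True
          by (simp add: norm_mult ennreal_mult mult_ac)
      qed simp
    qed
    then have "?L \<le> (\<integral>\<^sup>+x. inverse ?e *
        (ennreal (norm (f x * complex_of_real (w x)) powr p) * indicator Q x) \<partial>lebesgue)"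
      by (rule nn_integral_mono_AE)
    also have "\<dots> = inverse ?e * ?A"
      by (rule nn_integral_cmult) measurable
    finally show ?thesis
      using True V by (simp add: dual_avg_def mult.commute)
  next
    case False
    with p have p1: "1 < p" by simp
    define p' where "p' = conj_exp p"
    have p': "1 < p'" "1 / p' = 1 - 1 / p"
      using p1 by (auto simp: p'_def conj_exp_def field_simps)
    define F where "F x = norm (f x) * w x * indicator Q x" for x
    define G where "G x = w x powr (- 1) * indicator R x" for x
    have [measurable]: "F \<in> borel_measurable lebesgue" "G \<in> borel_measurable lebesgue"
      unfolding F_def G_def by measurable
    \<comment> \<open>The weights cancel where \<open>w\<close> is positive, hence almost
      everywhere, and the indicator of \<open>R\<close> is absorbed by that of
      \<open>Q\<close>.\<close>
    have "?L = (\<integral>\<^sup>+x. ennreal (F x * G x) \<partial>lebesgue)"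
      using w(2) \<open>Q \<subseteq> R\<close>
      by (intro nn_integral_cong_AE)
         (auto elim!: eventually_mono simp: F_def G_def powr_minus split: split_indicator)
    also have "\<dots> \<le> epow (\<integral>\<^sup>+x. ennreal (F x powr p) \<partial>lebesgue) (1 / p) *
        epow (\<integral>\<^sup>+x. ennreal (G x powr p') \<partial>lebesgue) (1 / p')"
      unfolding p'_def using w0 p1 by (intro Holder_nn_integral) (auto simp: F_def G_def)
    also have "(\<integral>\<^sup>+x. ennreal (F x powr p) \<partial>lebesgue) = ?A"
      using w0 by (intro nn_integral_cong) (auto simp: F_def norm_mult split: split_indicator)
    also have "(\<integral>\<^sup>+x. ennreal (G x powr p') \<partial>lebesgue) =
        (\<integral>\<^sup>+x\<in>R. ennreal (w x powr (- p')) \<partial>lebesgue)"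
      using w0 by (intro nn_integral_cong)
        (auto simp: G_def powr_divide powr_minus_divide split: split_indicator)
    also have "\<dots> = avg R (\<lambda>x. ennreal (w x powr (- p'))) * ennreal V"
      using V by (simp add: avg_def ennreal_divide_times)
    also have "epow \<dots> (1 / p') = dual_avg R p w * ennreal (V powr (1 - 1 / p))"
      using V False p' by (simp add: epow_mult epow_ennreal dual_avg_def p'_def)
    finally show ?thesis .
  qed
qed

text \<open>The product of the \<open>m\<close> bounds from \<open>nn_integral_le_dual_avg\<close>
  and the power of the integral of \<open>u\<close> contains exactly the term of the supremum
  \<open>weight_const\<close> that belongs to the fourfold cube. The remaining factors are powers of
  the two volumes.\<close>

lemma cube_weight_estimate:
  fixes c :: "real ^ 'n" and f :: "nat \<Rightarrow> real ^ 'n \<Rightarrow> complex"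
  assumes r: "0 < r"
    and p: "\<And>i. i \<in> {1..m} \<Longrightarrow> 1 \<le> p i"
    and q: "1 / q = (\<Sum>i=1..m. 1 / p i) - \<alpha> / real CARD('n)"
    and w: "\<And>i. i \<in> {1..m} \<Longrightarrow> weight (w i)"
      "\<And>i. i \<in> {1..m} \<Longrightarrow> AE x in lebesgue. 0 < w i x"
    and f: "\<And>i. i \<in> {1..m} \<Longrightarrow> f i \<in> borel_measurable lebesgue"
  shows "epow (\<integral>\<^sup>+x\<in>cube c (4 * r). ennreal (u x) \<partial>lebesgue) (1 / q) *
      (ennreal (measure lebesgue (cube c r) powr (\<alpha> / real CARD('n))) *
        (\<Prod>i=1..m. avg (cube c r) (\<lambda>y. ennreal (norm (f i y)))))
    \<le> ennreal (4 powr (real CARD('n) * real m - \<alpha>)) * weight_const m p q u w *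
      (\<Prod>i=1..m. epow (\<integral>\<^sup>+x\<in>cube c r.
        ennreal (norm (f i x * complex_of_real (w i x)) powr p i) \<partial>lebesgue) (1 / p i))"
proof -
  define n where "n = real CARD('n)"
  define Q where "Q = cube c r"
  define R where "R = cube c (4 * r)"
  define v where "v = (2 * r) ^ CARD('n)"
  define V where "V = (2 * (4 * r)) ^ CARD('n)"
  define a where "a i = epow (\<integral>\<^sup>+x\<in>Q.
    ennreal (norm (f i x * complex_of_real (w i x)) powr p i) \<partial>lebesgue) (1 / p i)" for i
  define d where "d i = dual_avg R (p i) (w i)" for i
  have n: "0 < n"
    by (simp add: n_def)
  have v: "0 < v" "emeasure lebesgue Q = ennreal v"
    using r emeasure_cube[of r c] by (simp_all only: v_def Q_def zero_less_power mult_pos_pos zero_less_numeral)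
  have V: "0 < V" "emeasure lebesgue R = ennreal V"
    using r emeasure_cube[of "4 * r" c] by (simp_all only: V_def R_def zero_less_power mult_pos_pos zero_less_numeral)
  have Vv: "V / v = 4 powr n"
    using r by (simp add: V_def v_def n_def powr_realpow flip: power_divide)
  have avg_le: "avg Q (\<lambda>y. ennreal (norm (f i y))) \<le> (a i * d i) * ennreal (V powr (1 - 1 / p i) / v)"
    if i: "i \<in> {1..m}" for i
  proof -
    have "avg Q (\<lambda>y. ennreal (norm (f i y))) \<le> a i * (d i * ennreal (V powr (1 - 1 / p i))) / ennreal v"
      unfolding avg_def v(2) a_def d_def
      using i r V p w f
      by (intro divide_right_mono_ennreal nn_integral_le_dual_avg) (auto simp: Q_def R_def intro!: cube_mono)
    also have "\<dots> = (a i * d i) * (ennreal (V powr (1 - 1 / p i)) / ennreal v)"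
      by (simp add: ennreal_times_divide mult.assoc)
    finally show ?thesis
      using v(1) by (simp add: divide_ennreal)
  qed
  have U: "(\<integral>\<^sup>+x\<in>R. ennreal (u x) \<partial>lebesgue) = avg R (\<lambda>x. ennreal (u x)) * ennreal V"
    using V by (simp add: avg_def ennreal_divide_times)
  have K: "epow (avg R (\<lambda>x. ennreal (u x))) (1 / q) * (\<Prod>i=1..m. d i) \<le> weight_const m p q u w"
    unfolding weight_const_def d_def R_def using r by (intro SUP_upper cube_in_cubes) simp
  \<comment> \<open>By the relation for 1/q the total exponent of \<open>V\<close> is m - \<alpha>/n
    and that of \<open>v\<close> is its negative. Only the ratio of the volumes survives, so the
    constant does not depend on \<open>r\<close>.\<close>
  have scalar: "V powr (1 / q) * (v powr (\<alpha> / n) * (\<Prod>i=1..m. V powr (1 - 1 / p i) / v)) =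
      4 powr (n * real m - \<alpha>)"
  proof -
    have "(\<Prod>i=1..m. V powr (1 - 1 / p i) / v) = V powr (real m - (\<Sum>i=1..m. 1 / p i)) / v powr real m"
      using V(1) v(1) by (simp add: prod_dividef powr_realpow sum_subtractf flip: powr_sum)
    then have "V powr (1 / q) * (v powr (\<alpha> / n) * (\<Prod>i=1..m. V powr (1 - 1 / p i) / v)) =
        V powr (1 / q + (real m - (\<Sum>i=1..m. 1 / p i))) * v powr (\<alpha> / n - real m)"
      by (simp add: powr_add powr_diff)
    also have "1 / q + (real m - (\<Sum>i=1..m. 1 / p i)) = real m - \<alpha> / n"
      using q by (simp add: n_def)
    also have "v powr (\<alpha> / n - real m) = inverse (v powr (real m - \<alpha> / n))"
      by (simp flip: powr_minus)
    also have "V powr (real m - \<alpha> / n) * inverse (v powr (real m - \<alpha> / n)) = (V / v) powr (real m - \<alpha> / n)"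
      using v(1) V(1) by (subst powr_divide) (simp_all add: divide_inverse less_imp_le)
    also have "\<dots> = 4 powr (n * real m - \<alpha>)"
      unfolding Vv powr_powr using n by (simp add: right_diff_distrib)
    finally show ?thesis .
  qed
  have "epow (\<integral>\<^sup>+x\<in>R. ennreal (u x) \<partial>lebesgue) (1 / q) *
      (ennreal (v powr (\<alpha> / n)) * (\<Prod>i=1..m. avg Q (\<lambda>y. ennreal (norm (f i y)))))
    \<le> (epow (avg R (\<lambda>x. ennreal (u x))) (1 / q) * ennreal (V powr (1 / q))) *
      (ennreal (v powr (\<alpha> / n)) * (\<Prod>i=1..m. (a i * d i) * ennreal (V powr (1 - 1 / p i) / v)))"
    using V(1) avg_le
    by (intro mult_mono prod_mono_ennreal) (auto simp: U epow_mult epow_ennreal)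
  also have "(\<Prod>i=1..m. (a i * d i) * ennreal (V powr (1 - 1 / p i) / v)) =
      (\<Prod>i=1..m. a i) * (\<Prod>i=1..m. d i) * ennreal (\<Prod>i=1..m. V powr (1 - 1 / p i) / v)"
    using v(1) by (simp add: prod.distrib prod_ennreal)
  also have "(epow (avg R (\<lambda>x. ennreal (u x))) (1 / q) * ennreal (V powr (1 / q))) *
      (ennreal (v powr (\<alpha> / n)) * ((\<Prod>i=1..m. a i) * (\<Prod>i=1..m. d i) *
        ennreal (\<Prod>i=1..m. V powr (1 - 1 / p i) / v))) =
      (ennreal (V powr (1 / q)) * (ennreal (v powr (\<alpha> / n)) * ennreal (\<Prod>i=1..m. V powr (1 - 1 / p i) / v))) *
      (epow (avg R (\<lambda>x. ennreal (u x))) (1 / q) * (\<Prod>i=1..m. d i)) * (\<Prod>i=1..m. a i)"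
    by (simp only: mult_ac)
  also have "ennreal (V powr (1 / q)) * (ennreal (v powr (\<alpha> / n)) * ennreal (\<Prod>i=1..m. V powr (1 - 1 / p i) / v))
      = ennreal (4 powr (n * real m - \<alpha>))"
    using v(1) by (simp add: prod_nonneg flip: scalar ennreal_mult)
  also have "\<dots> * (epow (avg R (\<lambda>x. ennreal (u x))) (1 / q) * (\<Prod>i=1..m. d i)) * (\<Prod>i=1..m. a i)
    \<le> ennreal (4 powr (n * real m - \<alpha>)) * weight_const m p q u w * (\<Prod>i=1..m. a i)"
    using K by (intro mult_right_mono mult_left_mono) auto
  finally show ?thesis
    using v by (simp add: Q_def R_def n_def a_def measure_def)
qed

section \<open>From single cubes to unions of cubes\<close>

text \<open>In the application \<open>s\<close> and \<open>B\<close> are the q-th powers of the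
  level and of the constant, and \<open>\<theta> i\<close> is q / p_i. The fourfold dilates of a
  Vitali subfamily cover the doubled cubes, so subadditivity reduces the claim to a sum of the right
  sides of \<open>bound\<close>, which \<open>sum_prod_epow_le\<close> turns into a product of
  sums.\<close>

lemma weak_type_finite:
  fixes I :: "((real ^ 'n) \<times> real) set" and g :: "'i \<Rightarrow> real ^ 'n \<Rightarrow> ennreal"
  assumes "finite I" and pos: "\<And>c r. (c, r) \<in> I \<Longrightarrow> 0 < r"
    and S: "finite S" "\<And>i. i \<in> S \<Longrightarrow> 0 < \<theta> i" "1 \<le> sum \<theta> S"
    and [measurable]: "u \<in> borel_measurable lebesgue"
    and g[measurable]: "\<And>i. i \<in> S \<Longrightarrow> g i \<in> borel_measurable lebesgue"
    and bound: "\<And>c r. (c, r) \<in> I \<Longrightarrow> s * (\<integral>\<^sup>+x\<in>cube c (4 * r). u x \<partial>lebesgue) \<le>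
      B * (\<Prod>i\<in>S. epow (\<integral>\<^sup>+x\<in>cube c r. g i x \<partial>lebesgue) (\<theta> i))"
  shows "s * (\<integral>\<^sup>+x\<in>(\<Union>(c, r)\<in>I. cube c (2 * r)). u x \<partial>lebesgue) \<le>
    B * (\<Prod>i\<in>S. epow (\<integral>\<^sup>+x. g i x \<partial>lebesgue) (\<theta> i))"
proof -
  obtain J where J: "J \<subseteq> I" "disjoint_family_on (\<lambda>(c, r). cube c r) J"
    "(\<Union>(c, r)\<in>I. cube c (2 * r)) \<subseteq> (\<Union>(c, r)\<in>J. cube c (4 * r))"
    using Vitali_finite_cubes[of I] \<open>finite I\<close> pos by metis
  have "finite J"
    using J(1) \<open>finite I\<close> finite_subset by blast
  define \<mu> where "\<mu> = density lebesgue u"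
  define b where "b i j = (\<integral>\<^sup>+x\<in>cube (fst j) (snd j). g i x \<partial>lebesgue)" for i j
  have \<mu>: "emeasure \<mu> A = (\<integral>\<^sup>+x\<in>A. u x \<partial>lebesgue)" if "A \<in> sets lebesgue" for A
    using that by (simp add: \<mu>_def emeasure_density)
  have sets_UN: "(\<Union>(c, r)\<in>I'. cube c (k * r)) \<in> sets lebesgue" if "finite I'"
    for k and I' :: "((real ^ 'n) \<times> real) set"
    using that by (intro sets.finite_UN) auto
  \<comment> \<open>Disjointness of the selected cubes enters here: the integrals over them add up
    to the integral over their union.\<close>
  have sum_b: "(\<Sum>j\<in>J. b i j) \<le> (\<integral>\<^sup>+x. g i x \<partial>lebesgue)" if i: "i \<in> S" for i
  proof -
    have "(\<Sum>j\<in>J. b i j) = (\<Sum>j\<in>J. emeasure (density lebesgue (g i)) (case j of (c, r) \<Rightarrow> cube c r))"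
      using g[OF i] by (intro sum.cong) (auto simp: b_def emeasure_density)
    also have "\<dots> = emeasure (density lebesgue (g i)) (\<Union>(c, r)\<in>J. cube c r)"
      using J(2) \<open>finite J\<close> by (intro sum_emeasure) auto
    also have "\<dots> \<le> emeasure (density lebesgue (g i)) (space (density lebesgue (g i)))"
      by (rule emeasure_space)
    also have "\<dots> = (\<integral>\<^sup>+x. g i x \<partial>lebesgue)"
      using g[OF i] by (simp add: emeasure_density)
    finally show ?thesis .
  qed
  have "s * (\<integral>\<^sup>+x\<in>(\<Union>(c, r)\<in>I. cube c (2 * r)). u x \<partial>lebesgue) =
      s * emeasure \<mu> (\<Union>(c, r)\<in>I. cube c (2 * r))"
    using sets_UN[OF \<open>finite I\<close>] by (simp add: \<mu>)
  also have "\<dots> \<le> s * emeasure \<mu> (\<Union>(c, r)\<in>J. cube c (4 * r))"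
    using J(3) sets_UN[OF \<open>finite J\<close>] by (intro mult_left_mono emeasure_mono) (auto simp: \<mu>_def)
  also have "\<dots> \<le> s * (\<Sum>j\<in>J. emeasure \<mu> (case j of (c, r) \<Rightarrow> cube c (4 * r)))"
    using \<open>finite J\<close> by (intro mult_left_mono emeasure_subadditive_finite) (auto simp: \<mu>_def)
  also have "\<dots> = (\<Sum>j\<in>J. s * (\<integral>\<^sup>+x\<in>cube (fst j) (4 * snd j). u x \<partial>lebesgue))"
    by (simp add: sum_distrib_left \<mu> case_prod_beta)
  also have "\<dots> \<le> (\<Sum>j\<in>J. B * (\<Prod>i\<in>S. epow (b i j) (\<theta> i)))"
    using J(1) unfolding b_def by (intro sum_mono bound) auto
  also have "\<dots> = B * (\<Sum>j\<in>J. \<Prod>i\<in>S. epow (b i j) (\<theta> i))"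
    by (simp add: sum_distrib_left)
  also have "\<dots> \<le> B * (\<Prod>i\<in>S. epow (\<Sum>j\<in>J. b i j) (\<theta> i))"
    using S \<open>finite J\<close> by (intro mult_left_mono sum_prod_epow_le) auto
  also have "\<dots> \<le> B * (\<Prod>i\<in>S. epow (\<integral>\<^sup>+x. g i x \<partial>lebesgue) (\<theta> i))"
    using S sum_b by (intro mult_left_mono prod_mono_ennreal epow_mono) (auto simp: less_imp_le)
  finally show ?thesis .
qed

text \<open>
  Passing to doubled cubes, whose interiors still cover, makes the Lindeloef property applicable
  without knowing that the set covered by the original cubes is open or even measurable.
\<close>

lemma weak_type_covering:
  fixes P :: "((real ^ 'n) \<times> real) set" and g :: "'i \<Rightarrow> real ^ 'n \<Rightarrow> ennreal"
  assumes pos: "\<And>c r. (c, r) \<in> P \<Longrightarrow> 0 < r"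
    and S: "finite S" "\<And>i. i \<in> S \<Longrightarrow> 0 < \<theta> i" "1 \<le> sum \<theta> S"
    and u[measurable]: "u \<in> borel_measurable lebesgue"
    and g: "\<And>i. i \<in> S \<Longrightarrow> g i \<in> borel_measurable lebesgue"
    and bound: "\<And>c r. (c, r) \<in> P \<Longrightarrow> s * (\<integral>\<^sup>+x\<in>cube c (4 * r). u x \<partial>lebesgue) \<le>
      B * (\<Prod>i\<in>S. epow (\<integral>\<^sup>+x\<in>cube c r. g i x \<partial>lebesgue) (\<theta> i))"
  shows "s * (\<integral>\<^sup>+x\<in>(\<Union>(c, r)\<in>P. cube c r). u x \<partial>lebesgue) \<le>
    B * (\<Prod>i\<in>S. epow (\<integral>\<^sup>+x. g i x \<partial>lebesgue) (\<theta> i))"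
proof -
  define D where "D j = cube (fst j) (2 * snd j)" for j :: "(real ^ 'n) \<times> real"
  \<comment> \<open>Lindelof yields a countable family of open sets; choosing one index for each of
    them gives a countable set of cubes.\<close>
  obtain P' where P': "P' \<subseteq> P" "countable P'" "(\<Union>j\<in>P'. interior (D j)) = (\<Union>j\<in>P. interior (D j))"
  proof -
    obtain F where F: "F \<subseteq> (\<lambda>j. interior (D j)) ` P" "countable F"
      "\<Union>F = \<Union>((\<lambda>j. interior (D j)) ` P)"
      by (rule Lindelof[of "(\<lambda>j. interior (D j)) ` P"]) auto
    then obtain P' where "countable P'" "P' \<subseteq> P" "F = (\<lambda>j. interior (D j)) ` P'"
      using countable_subset_image[of F "\<lambda>j. interior (D j)" P] by auto
    then show thesis
      using that F(3) by simp
  qed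
  have cover: "(\<Union>(c, r)\<in>P. cube c r) \<subseteq> (\<Union>j\<in>P'. D j)"
  proof -
    have "(\<Union>(c, r)\<in>P. cube c r) \<subseteq> (\<Union>j\<in>P. interior (D j))"
    proof (intro UN_mono order_refl, clarify)
      fix c x r assume "(c, r) \<in> P" "x \<in> cube c r"
      then show "x \<in> interior (D (c, r))"
        using cube_subset_interior_double[OF pos] by (auto simp: D_def)
    qed
    also have "\<dots> \<subseteq> (\<Union>j\<in>P'. D j)"
      unfolding P'(3)[symmetric] using interior_subset by blast
    finally show ?thesis .
  qed
  show ?thesis
  proof (cases "P' = {}")
    case True
    then have "(\<Union>(c, r)\<in>P. cube c r) = {}"
      using cover by auto
    then show ?thesis by (simp only:) simp
  next
    case False
    \<comment> \<open>The enumeration may repeat cubes when \<open>P'\<close> is finite, which is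
      harmless for the increasing unions \<open>E N\<close>.\<close>
    define e where "e = from_nat_into P'"
    have e: "range e = P'"
      unfolding e_def using False P'(2) by (rule range_from_nat_into)
    define E where "E N = (\<Union>j\<in>e ` {..N}. D j)" for N :: nat
    have E_sets: "E N \<in> sets lebesgue" for N
      unfolding E_def D_def by (intro sets.finite_UN) auto
    have E_mono: "incseq E"
      unfolding incseq_def E_def by (intro allI impI UN_mono image_mono) auto
    have E_Un: "(\<Union>N. E N) = (\<Union>j\<in>P'. D j)"
      by (auto simp: E_def e[symmetric])
    have E_bound: "s * (\<integral>\<^sup>+x\<in>E N. u x \<partial>lebesgue) \<le>
        B * (\<Prod>i\<in>S. epow (\<integral>\<^sup>+x. g i x \<partial>lebesgue) (\<theta> i))" for N
    proof -
      have sub: "e ` {..N} \<subseteq> P"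
        using e P'(1) by blast
      have E_eq: "E N = (\<Union>(c, r)\<in>e ` {..N}. cube c (2 * r))"
        by (simp add: E_def D_def case_prod_beta)
      show ?thesis
        unfolding E_eq
      proof (rule weak_type_finite)
        fix c r assume "(c, r) \<in> e ` {..N}"
        then have "(c, r) \<in> P"
          using sub by blast
        then show "0 < r" and "s * (\<integral>\<^sup>+x\<in>cube c (4 * r). u x \<partial>lebesgue) \<le>
            B * (\<Prod>i\<in>S. epow (\<integral>\<^sup>+x\<in>cube c r. g i x \<partial>lebesgue) (\<theta> i))"
          by (fact pos bound)+
      qed (use S u g in auto)
    qed
    \<comment> \<open>The set on the left may be non-measurable, but \<open>nn_integral\<close> is
      monotone for arbitrary functions; continuity from below is then applied to the measurable sets
      \<open>E N\<close>.\<close>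
    have "(\<integral>\<^sup>+x\<in>(\<Union>(c, r)\<in>P. cube c r). u x \<partial>lebesgue) \<le> (\<integral>\<^sup>+x\<in>(\<Union>N. E N). u x \<partial>lebesgue)"
      using cover unfolding E_Un
      by (intro nn_integral_mono mult_left_mono) (auto simp: indicator_def)
    also have "\<dots> = emeasure (density lebesgue u) (\<Union>N. E N)"
      using E_sets by (subst emeasure_density) auto
    also have "\<dots> = (SUP N. emeasure (density lebesgue u) (E N))"
      using E_sets E_mono by (intro SUP_emeasure_incseq[symmetric]) auto
    also have "\<dots> = (SUP N. \<integral>\<^sup>+x\<in>E N. u x \<partial>lebesgue)"
      using E_sets by (simp add: emeasure_density)
    finally have "s * (\<integral>\<^sup>+x\<in>(\<Union>(c, r)\<in>P. cube c r). u x \<partial>lebesgue) \<le>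
        (SUP N. s * (\<integral>\<^sup>+x\<in>E N. u x \<partial>lebesgue))"
      by (simp add: mult_left_mono flip: SUP_mult_left_ennreal)
    also have "\<dots> \<le> B * (\<Prod>i\<in>S. epow (\<integral>\<^sup>+x. g i x \<partial>lebesgue) (\<theta> i))"
      using E_bound by (rule SUP_least)
    finally show ?thesis .
  qed
qed

section \<open>The weak-type bound for the maximal operator\<close>

theorem theorem2p8:
  fixes m :: nat and \<alpha> q :: real and p qs :: "nat \<Rightarrow> real"
    and u :: "real ^ 'n \<Rightarrow> real" and w :: "nat \<Rightarrow> real ^ 'n \<Rightarrow> real"
  assumes "1 \<le> m"
    and "0 < \<alpha>" and "\<alpha> < real CARD('n) * real m"
    and "\<And>i. i \<in> {1..m} \<Longrightarrow> 1 \<le> p i \<and> p i < real CARD('n) * real m / \<alpha>"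
    and "\<And>i. i \<in> {1..m} \<Longrightarrow> 1 / qs i = 1 / p i - \<alpha> / (real CARD('n) * real m)"
    and "1 / q = (\<Sum>i=1..m. 1 / qs i)"
    and "weight u"
    and "\<And>i. i \<in> {1..m} \<Longrightarrow> weight (w i)"
    and "\<And>i. i \<in> {1..m} \<Longrightarrow> AE x in lebesgue. 0 < w i x"
    and "weight_const m p q u w < \<infinity>"
  shows "\<exists>C::real. C > 0 \<and>
    (\<forall>f :: nat \<Rightarrow> real ^ 'n \<Rightarrow> complex.
      (\<forall>i\<in>{1..m}. f i \<in> borel_measurable lebesgue) \<longrightarrow>
      weak_Lq_norm q u (frac_maximal m \<alpha> f)
        \<le> ennreal C * (\<Prod>i=1..m. Lp_norm (p i) (\<lambda>x. f i x * complex_of_real (w i x))))"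
proof -
  have p: "1 \<le> p i" if "i \<in> {1..m}" for i
    using assms(4) that by blast
  have q: "1 / q = (\<Sum>i=1..m. 1 / p i) - \<alpha> / real CARD('n)"
    using assms(1,5,6) by (simp add: sum_subtractf)
  \<comment> \<open>The upper bound on \<open>p i\<close> says precisely that
    \<open>1 / qs i\<close> is positive. This yields \<open>0 < q\<close>, so that taking q-th
    powers and roots preserves inequalities.\<close>
  have "0 < (\<Sum>i=1..m. 1 / qs i)"
  proof (rule sum_pos)
    fix i assume i: "i \<in> {1..m}"
    then have "p i * \<alpha> < real CARD('n) * real m"
      using assms(2) assms(4)[OF i] by (simp add: less_divide_eq)
    then have "\<alpha> / (real CARD('n) * real m) < 1 / p i"
      using assms(1) p[OF i] by (simp add: field_simps)
    then show "0 < 1 / qs i"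
      using assms(5)[OF i] by simp
  qed (use assms(1) in auto)
  then have "0 < q"
    using assms(6) by (metis zero_less_divide_1_iff)
  have "1 / q < (\<Sum>i=1..m. 1 / p i)"
    using q assms(2) by simp
  \<comment> \<open>This is the exponent condition of the discrete Hoelder inequality; it comes from
    subtracting the positive \<alpha>/n in the formula for 1/q.\<close>
  then have sum_ge: "1 \<le> (\<Sum>i=1..m. q / p i)"
    using \<open>0 < q\<close> by (simp add: divide_less_eq sum_distrib_right less_imp_le)
  obtain K where K: "weight_const m p q u w = ennreal K" "0 \<le> K"
    using assms(10) by (cases "weight_const m p q u w") auto
  define A where "A = 4 powr (real CARD('n) * real m - \<alpha>) * K"
  have A: "ennreal (4 powr (real CARD('n) * real m - \<alpha>)) * weight_const m p q u w = ennreal A" "0 \<le> A"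
    using K by (simp_all add: A_def ennreal_mult)
  have [measurable]: "(\<lambda>x. ennreal (u x)) \<in> borel_measurable lebesgue"
    using assms(7) by (simp add: weight_def)
  \<comment> \<open>The constant is \<open>A + 1\<close> because \<open>A\<close> may be 0 while a
    positive constant is required.\<close>
  have "weak_Lq_norm q u (frac_maximal m \<alpha> f)
      \<le> ennreal (A + 1) * (\<Prod>i=1..m. Lp_norm (p i) (\<lambda>x. f i x * complex_of_real (w i x)))"
    if f: "\<And>i. i \<in> {1..m} \<Longrightarrow> f i \<in> borel_measurable lebesgue" for f :: "nat \<Rightarrow> real ^ 'n \<Rightarrow> complex"
    unfolding weak_Lq_norm_def
  proof (rule SUP_least)
    fix t :: real assume "t \<in> {0<..}"
    define g where "g i x = ennreal (norm (f i x * complex_of_real (w i x)) powr p i)" for i x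
    define \<Phi> where "\<Phi> Q = ennreal (measure lebesgue Q powr (\<alpha> / real CARD('n))) *
      (\<Prod>i=1..m. avg Q (\<lambda>y. ennreal (norm (f i y))))" for Q
    define P where "P = {(c, r). 0 < r \<and> ennreal t < \<Phi> (cube c r)}"
    have g: "g i \<in> borel_measurable lebesgue" if i: "i \<in> {1..m}" for i
    proof -
      have [measurable]: "f i \<in> borel_measurable lebesgue" "w i \<in> borel_measurable lebesgue"
        using f[OF i] assms(8)[OF i] by (auto simp: weight_def)
      show ?thesis unfolding g_def by measurable
    qed
    \<comment> \<open>Taking the q-th power makes the single-cube estimate linear in the integral of
      \<open>u\<close>, hence summable over cubes, and turns the exponents 1 / p_i into q /
      p_i.\<close>
    have bound: "epow (ennreal t) q * (\<integral>\<^sup>+x\<in>cube c (4 * r). ennreal (u x) \<partial>lebesgue) \<le>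
        epow (ennreal A) q * (\<Prod>i=1..m. epow (\<integral>\<^sup>+x\<in>cube c r. g i x \<partial>lebesgue) (q / p i))"
      if "(c, r) \<in> P" for c r
    proof -
      let ?U = "\<integral>\<^sup>+x\<in>cube c (4 * r). ennreal (u x) \<partial>lebesgue"
      let ?G = "\<lambda>i. \<integral>\<^sup>+x\<in>cube c r. g i x \<partial>lebesgue"
      have "epow ?U (1 / q) * ennreal t \<le> epow ?U (1 / q) * \<Phi> (cube c r)"
        using that by (intro mult_left_mono) (auto simp: P_def)
      also have "\<dots> \<le> ennreal A * (\<Prod>i=1..m. epow (?G i) (1 / p i))"
        unfolding \<Phi>_def A(1)[symmetric] g_def
        using that p q assms(8,9) f by (intro cube_weight_estimate) (auto simp: P_def)
      finally have "epow (epow ?U (1 / q) * ennreal t) q \<le>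
          epow (ennreal A * (\<Prod>i=1..m. epow (?G i) (1 / p i))) q"
        using \<open>0 < q\<close> by (intro epow_mono) auto
      then show ?thesis
        using \<open>0 < q\<close> by (simp add: epow_mult epow_prod epow_epow mult.commute)
    qed
    have "{x. ennreal t < frac_maximal m \<alpha> f x} \<subseteq> (\<Union>(c, r)\<in>P. cube c r)"
    proof
      fix x assume "x \<in> {x. ennreal t < frac_maximal m \<alpha> f x}"
      then obtain Q where Q: "Q \<in> cubes" "x \<in> Q" "ennreal t < \<Phi> Q"
        by (auto simp: frac_maximal_def less_SUP_iff \<Phi>_def)
      then show "x \<in> (\<Union>(c, r)\<in>P. cube c r)"
        by (elim cubesE) (auto simp: P_def)
    qed
    then have "epow (ennreal t) q *
        (\<integral>\<^sup>+x\<in>{x. ennreal t < frac_maximal m \<alpha> f x}. ennreal (u x) \<partial>lebesgue) \<le>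
        epow (ennreal t) q * (\<integral>\<^sup>+x\<in>(\<Union>(c, r)\<in>P. cube c r). ennreal (u x) \<partial>lebesgue)"
      by (intro mult_left_mono nn_integral_mono) (auto simp: indicator_def)
    also have "\<dots> \<le> epow (ennreal A) q *
        (\<Prod>i=1..m. epow (\<integral>\<^sup>+x. g i x \<partial>lebesgue) (q / p i))"
    proof (rule weak_type_covering)
      show "0 < q / p i" if "i \<in> {1..m}" for i
        using \<open>0 < q\<close> p[OF that] by simp
    qed (use sum_ge g bound in \<open>auto simp: P_def\<close>)
    \<comment> \<open>The q-th root undoes that power and restores the norms with exponents 1 /
      p_i.\<close>
    finally have "epow (epow (ennreal t) q *
          (\<integral>\<^sup>+x\<in>{x. ennreal t < frac_maximal m \<alpha> f x}. ennreal (u x) \<partial>lebesgue)) (1 / q) \<le>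
        epow (epow (ennreal A) q * (\<Prod>i=1..m. epow (\<integral>\<^sup>+x. g i x \<partial>lebesgue) (q / p i))) (1 / q)"
      using \<open>0 < q\<close> by (intro epow_mono) auto
    then have "ennreal t *
          epow (\<integral>\<^sup>+x\<in>{x. ennreal t < frac_maximal m \<alpha> f x}. ennreal (u x) \<partial>lebesgue) (1 / q) \<le>
        ennreal A * (\<Prod>i=1..m. Lp_norm (p i) (\<lambda>x. f i x * complex_of_real (w i x)))"
      using \<open>0 < q\<close> by (simp add: epow_mult epow_prod epow_epow Lp_norm_def g_def)
    also have "\<dots> \<le> ennreal (A + 1) * (\<Prod>i=1..m. Lp_norm (p i) (\<lambda>x. f i x * complex_of_real (w i x)))"
      by (intro mult_right_mono ennreal_leI) auto
    finally show "ennreal t *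
          epow (\<integral>\<^sup>+x\<in>{x. ennreal t < frac_maximal m \<alpha> f x}. ennreal (u x) \<partial>lebesgue) (1 / q) \<le>
        ennreal (A + 1) * (\<Prod>i=1..m. Lp_norm (p i) (\<lambda>x. f i x * complex_of_real (w i x)))" .
  qed
  then show ?thesis
    using A(2) by (intro exI[of _ "A + 1"]) auto
qed

end
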